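(* Let $N\ge 1$, let $x$ be a random vector in $\mathbb{R}^N$ following a distribution $f(\cdot)$ with mean $\mu\in\mathbb{R}^N$ and covariance matrix $\Sigma\in\mathbb{R}^{N\times N}$ (both finite). Let $\mathcal{A}_{0:t}\in\mathbb{R}^{k_t\times N}$ and $o_{0:t}\in\mathbb{R}^{k_t}$ be given (deterministic), and let $$C_t=\left\{z\in\mathbb{R}^N:\ \mathcal{A}_{0:t}\,z=o_{0:t},\quad 0\le [z]_j\le 1,\ j=1,\ldots,N\right\}.$$ Let $\widehat{x}^*_t$ be the estimate defined by $$\widehat{x}^*_t=\operatorname*{arg\,min}_{\widehat{x}_t\in C_t}\ \sum_{j=1}^N \mathbb{E}\left[\left([x]_j-[\widehat{x}_t]_j\right)^2\right].$$ Then $$\widehat{x}^*_t=\operatorname*{arg\,min}_{\widehat{x}_t\in C_t}\ \|\widehat{x}_t-\mu\|^2 .$$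
   Context: For a vector $z\in\mathbb{R}^N$, $[z]_j$ denotes its $j$-th component and $\|\cdot\|$ is the Euclidean norm. The vector $x$ models the (unknown) occupancy values of the $N$ cells of a grid environment. The matrix $\mathcal{A}_{0:t}$ and the vector $o_{0:t}$ collect the $k_t$ linear equality constraints on the occupancy values obtained from measurements and received compressed maps up to time $t$, with redundant (linearly dependent) equations removed. The candidate estimates $\widehat{x}_t\in C_t$ are deterministic vectors, and the expectation $\mathbb{E}$ is the unconditional expectation with respect to the distribution $f$ of $x$. The equality in the conclusion is an equality of the minimizers over $C_t$ of the two objective functions (i.e. $\operatorname*{arg\,min}$ may be read as the set of minimizers). *)

theory Defs
  imports "HOL-Probability.Probability"
begin

(* Integrability is part of both predicates: the Bochner integral of a non-integrable
   function is 0, so an equation alone would not say that the moment is finite. *)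

definition has_mean :: "'w measure \<Rightarrow> ('w \<Rightarrow> real ^ 'n) \<Rightarrow> real ^ 'n \<Rightarrow> bool" where
  "has_mean M x \<mu> \<longleftrightarrow> integrable M x \<and> (\<integral>\<omega>. x \<omega> \<partial>M) = \<mu>"

definition has_covariance_matrix ::
    "'w measure \<Rightarrow> ('w \<Rightarrow> real ^ 'n) \<Rightarrow> real ^ 'n ^ 'n \<Rightarrow> bool" where
  "has_covariance_matrix M x S \<longleftrightarrow>
     (let m = (\<integral>\<omega>. x \<omega> \<partial>M) in
        integrable M x \<and>
        (\<forall>i j. integrable M (\<lambda>\<omega>. (x \<omega> $ i - m $ i) * (x \<omega> $ j - m $ j)) \<and>
               (\<integral>\<omega>. (x \<omega> $ i - m $ i) * (x \<omega> $ j - m $ j) \<partial>M) = S $ i $ j))"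

(* The k \<times> N matrix is given by its rows A 0, ..., A (k - 1), and the right-hand side
   by b 0, ..., b (k - 1). Rows are not indexed by a type because types are nonempty and
   k = 0 (no equality constraint) is to be allowed. *)

definition feasible_set ::
    "nat \<Rightarrow> (nat \<Rightarrow> real ^ 'n) \<Rightarrow> (nat \<Rightarrow> real) \<Rightarrow> (real ^ 'n) set" where
  "feasible_set k A b =
     {z. (\<forall>i<k. (\<Sum>j\<in>UNIV. A i $ j * z $ j) = b i) \<and> (\<forall>j. 0 \<le> z $ j \<and> z $ j \<le> 1)}"

definition argmin_set :: "('a \<Rightarrow> real) \<Rightarrow> 'a set \<Rightarrow> 'a set" where
  "argmin_set f C = {z. is_arg_min f (\<lambda>y. y \<in> C) z}"

end

theory Submission
  imports Defs
begin

text \<open>This is the bias-variance decomposition, coordinate by coordinate: expanding around the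
  mean leaves a squared bias and a variance, as the cross term averages to zero
  (\<open>mean_square_deviation\<close>). Summed over coordinates, the biases give the squared norm.
  Adding a constant preserves every comparison between feasible points, hence the whole set of
  minimizers, even an empty one (\<open>argmin_set_add_const\<close>).\<close>

text \<open>The objective equals the squared distance to the mean plus the trace of the covariance
  matrix, and the latter does not depend on the estimate.\<close>

lemma argmin_set_add_const:
  "argmin_set (\<lambda>z. g z + c) C = argmin_set g C"
  by (simp add: argmin_set_def is_arg_min_def)

text \<open>Write X - c = (X - m) + (m - c) with m the mean: the mixed term is a constant times the
  centred variable X - m, whose expectation is zero.\<close>

lemma (in prob_space) mean_square_deviation:
  fixes X :: "'a \<Rightarrow> real"
  assumes X: "integrable M X"
    and V: "integrable M (\<lambda>\<omega>. (X \<omega> - expectation X)\<^sup>2)"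
  shows "expectation (\<lambda>\<omega>. (X \<omega> - c)\<^sup>2) = (c - expectation X)\<^sup>2 + variance X"
proof -
  define m where "m = expectation X"
  have V': "integrable M (\<lambda>\<omega>. (X \<omega> - m)\<^sup>2)"
    using V by (simp add: m_def)
  \<comment> \<open>Splitting the Bochner integral of a sum requires each summand to be
    integrable.\<close>
  have cross: "integrable M (\<lambda>\<omega>. 2 * (m - c) * (X \<omega> - m))"
    using X by simp
  have "expectation (\<lambda>\<omega>. (X \<omega> - c)\<^sup>2)
      = expectation (\<lambda>\<omega>. (X \<omega> - m)\<^sup>2 + 2 * (m - c) * (X \<omega> - m) + (c - m)\<^sup>2)"
    by (simp add: power2_eq_square algebra_simps)
  also have "\<dots> = expectation (\<lambda>\<omega>. (X \<omega> - m)\<^sup>2)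
      + expectation (\<lambda>\<omega>. 2 * (m - c) * (X \<omega> - m)) + (c - m)\<^sup>2"
    using V' cross by (simp add: prob_space)
  also have "expectation (\<lambda>\<omega>. 2 * (m - c) * (X \<omega> - m)) = 0"
    using X by (simp add: prob_space m_def)
  finally show ?thesis
    by (simp add: m_def)
qed

lemma norm_power2_eq_sum_components:
  fixes v :: "real ^ 'n"
  shows "(norm v)\<^sup>2 = (\<Sum>j\<in>UNIV. (v $ j)\<^sup>2)"
  by (simp add: norm_vec_def L2_set_def sum_nonneg)

theorem proposition1:
  fixes M :: "'w measure"
    and x :: "'w \<Rightarrow> real ^ 'n"
    and f :: "(real ^ 'n) measure"
    and \<mu> :: "real ^ 'n"
    and \<Sigma> :: "real ^ 'n ^ 'n"
    and k :: nat
    and A :: "nat \<Rightarrow> real ^ 'n"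
    and b :: "nat \<Rightarrow> real"
  assumes "prob_space M"
    and "x \<in> borel_measurable M"
    and "distr M borel x = f"
    and "has_mean M x \<mu>"
    and "has_covariance_matrix M x \<Sigma>"
  shows "argmin_set (\<lambda>z. \<Sum>j\<in>UNIV. \<integral>\<omega>. (x \<omega> $ j - z $ j)\<^sup>2 \<partial>M) (feasible_set k A b)
       = argmin_set (\<lambda>z. (norm (z - \<mu>))\<^sup>2) (feasible_set k A b)"
proof -
  interpret prob_space M by fact
  have x: "integrable M x" and mean: "expectation x = \<mu>"
    using assms(4) by (simp_all add: has_mean_def)
  \<comment> \<open>Coordinate projections are bounded linear, so they commute with the
    vector-valued integral.\<close>
  have comp: "integrable M (\<lambda>\<omega>. x \<omega> $ j)" "expectation (\<lambda>\<omega>. x \<omega> $ j) = \<mu> $ j" for j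
    using integrable_bounded_linear[OF bounded_linear_vec_nth x]
      integral_bounded_linear[OF bounded_linear_vec_nth x] mean by auto
  \<comment> \<open>The diagonal case i = j of the covariance condition, with the mean written as
    \<mu>.\<close>
  have cov: "integrable M (\<lambda>\<omega>. (x \<omega> $ j - \<mu> $ j)\<^sup>2)"
      "expectation (\<lambda>\<omega>. (x \<omega> $ j - \<mu> $ j)\<^sup>2) = \<Sigma> $ j $ j" for j
    using assms(5) mean by (auto simp: has_covariance_matrix_def Let_def power2_eq_square)
  have "expectation (\<lambda>\<omega>. (x \<omega> $ j - z $ j)\<^sup>2) = (z $ j - \<mu> $ j)\<^sup>2 + \<Sigma> $ j $ j" for z j
    using mean_square_deviation[OF comp(1), of j "z $ j"] comp(2) cov by simp
  \<comment> \<open>The variances sum to the trace of \<Sigma>, which is free of z.\<close>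
  then have "(\<Sum>j\<in>UNIV. expectation (\<lambda>\<omega>. (x \<omega> $ j - z $ j)\<^sup>2))
      = (norm (z - \<mu>))\<^sup>2 + (\<Sum>j\<in>UNIV. \<Sigma> $ j $ j)" for z
    by (simp add: sum.distrib norm_power2_eq_sum_components)
  then show ?thesis
    by (simp add: argmin_set_add_const)
qed

end
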